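(* Let $J,n,s\in\mathbb{N}$, let $\mathcal{J}\subseteq\{1,\dots,J\}$ be non-empty, and let $\mathring{x}\in\mathbb{R}^n$. For $j\in\mathcal{J}$, let $\varphi^{[j]}:\mathbb{R}^n\to\mathbb{R}$ be abs-smooth, represented by an evaluation procedure $(f^{[j]},c^{[j]})$ with $s$ switching variables and solution operator $z^{[j]}[\cdot]$; let $\mathring{z}^{[j]}=z^{[j]}[\mathring{x}]$, $\mathring{\sigma}^{[j]}=\operatorname{sign}(\mathring{z}^{[j]})\in\{-1,0,1\}^s$, and let $Z^{[j]}=\partial_1 c^{[j]}(\mathring{x},|\mathring{z}^{[j]}|,\mathring{z}^{[j]})\in\mathbb{R}^{s\times n}$. If there exists a common right-inverse $Z^\dagger\in\mathbb{R}^{n\times s}$ for all $Z^{[j]}$, i.e. $Z^{[j]}Z^\dagger=I_s$ for all $j\in\mathcal{J}$, then for all $\tau\in\{-1,1\}^s$, $$\frac1{|\mathcal{J}|}\sum_{j\in\mathcal{J}}\nabla\varphi^{[j]}_{\sigma^{[j]}_\tau}(\mathring{x})\in\partial_L\Big(\frac1{|\mathcal{J}|}\sum_{j\in\mathcal{J}}\varphi^{[j]}\Big)(\mathring{x}),\quad\text{where }(\sigma^{[j]}_\tau)_k:=\begin{cases}\tau_k&\text{if }\mathring{\sigma}^{[j]}_k=0,\\ \mathring{\sigma}^{[j]}_k&\text{else.}\end{cases}$$ Moreover, for $\zeta\in[-1,1]^s$ it holds $$\frac1{|\mathcal{J}|}\sum_{j\in\mathcal{J}}\nabla\varphi^{[j]}_{\xi^{[j]}_\zeta}(\mathring{x})\in\partial_C\Big(\frac1{|\mathcal{J}|}\sum_{j\in\mathcal{J}}\varphi^{[j]}\Big)(\mathring{x}),\quad\text{where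 }(\xi^{[j]}_\zeta)_k:=\begin{cases}\zeta_k&\text{if }\mathring{\sigma}^{[j]}_k=0,\\ \mathring{\sigma}^{[j]}_k&\text{else.}\end{cases}$$
   Context: Evaluation procedures. Let $n,s\in\mathbb{N}$, $f\in C^2(\mathbb{R}^n\times\mathbb{R}^s\times\mathbb{R}^s;\mathbb{R})$ and $c\in C^2(\mathbb{R}^n\times\mathbb{R}^s\times\mathbb{R}^s;\mathbb{R}^s)$, with $\partial_1,\partial_2,\partial_3$ denoting the partial derivatives with respect to the first, second and third (vector) argument, such that for any pair $(x,z)\in\mathbb{R}^n\times\mathbb{R}^s$ the matrices $\partial_2 c(x,|z|,z)$ and $\partial_3 c(x,|z|,z)$ in $\mathbb{R}^{s\times s}$ are strictly lower triangular (componentwise absolute value). Then for every $x$ the switching equation $z=c(x,|z|,z)$ has a unique solution, denoted $z[x]\in\mathbb{R}^s$; $z[\cdot]$ is the solution operator. If $\varphi(x)=f(x,|z[x]|,z[x])$ for all $x\in\mathbb{R}^n$, then $(f,c)$ is called an evaluation procedure of $\varphi$ (with $s$ switching variables), and $\varphi$ is called abs-smooth. $\operatorname{sign}$ acts componentwise with values in $\{-1,0,1\}$. Smooth models. Fix $\mathring{x}$ and let $\xi\in[-1,1]^s$ satisfy $\xi_k=\operatorname{sign}(z[\mathring{x}]_k)$ whenever $z[\mathring{x}]_k\neq0$; with $\Xi=\operatorname{diag}(\xi)$ one then has $\Xi z[\mathring{x}]=|z[\mathring{x}]|$. Let $z_\xi[\cdot]$ be the solution operator of the modified switching equation $z_\xi=c(x,\Xi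 z_\xi,z_\xi)$, with $z_\xi[\mathring{x}]=z[\mathring{x}]$, and set $\varphi_\xi(x)=f(x,\Xi z_\xi[x],z_\xi[x])$, so that $\varphi_\xi(\mathring{x})=\varphi(\mathring{x})$. Only $\nabla\varphi_\xi(\mathring{x})$ is used, so it suffices to consider $z_\xi[\cdot]$ near $\mathring{x}$, where it is a $C^2$ function by the implicit function theorem. The function $\varphi^{[j]}_\xi$ is obtained in this way from $(f^{[j]},c^{[j]})$; the vectors $\sigma^{[j]}_\tau$ and $\xi^{[j]}_\zeta$ are admissible choices of $\xi$ for it. Generalized gradients. For locally Lipschitz $\varphi$, $\partial_L\varphi(\mathring{x})$ (limiting gradients) is the set of all $g=\lim_k\nabla\varphi(x_k)$ where $x_k\to\mathring{x}$ and $\varphi$ is differentiable at every $x_k$; the set of Clarke generalized gradients is $\partial_C\varphi(\mathring{x})=\operatorname{conv}\partial_L\varphi(\mathring{x})$, where $\operatorname{conv}$ is the convex hull. *)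

theory Defs
  imports "HOL-Analysis.Analysis"
begin

definition C2 :: "('a::real_normed_vector \<Rightarrow> 'b::real_normed_vector) \<Rightarrow> bool" where
  "C2 f \<longleftrightarrow>
    (\<exists>(f' :: 'a \<Rightarrow> 'a \<Rightarrow>\<^sub>L 'b) (f'' :: 'a \<Rightarrow> 'a \<Rightarrow>\<^sub>L 'a \<Rightarrow>\<^sub>L 'b).
       (\<forall>p. (f has_derivative blinfun_apply (f' p)) (at p)) \<and>
       (\<forall>p. (f' has_derivative blinfun_apply (f'' p)) (at p)) \<and>
       continuous_on UNIV f'')"

text \<open>The linear order on the index type stands for the order of the indices \<open>1, \<dots>, s\<close>.\<close>

definition strictly_lower_triangular :: "real^('s::{finite,linorder})^('s::{finite,linorder}) \<Rightarrow> bool" where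
  "strictly_lower_triangular A \<longleftrightarrow> (\<forall>i j. i \<le> j \<longrightarrow> A $ i $ j = 0)"

text \<open>The library function \<open>sgn\<close> on vectors is \<open>x / norm x\<close>, hence the componentwise
  version here. The absolute value \<open>\<bar>z\<bar>\<close> on vectors, in contrast, is the componentwise one.\<close>

definition sign_vec :: "real^('s::finite) \<Rightarrow> real^'s" where
  "sign_vec z = (\<chi> k. sgn (z $ k))"

definition diag_mat :: "real^('s::finite) \<Rightarrow> real^'s^'s" where
  "diag_mat \<xi> = (\<chi> i j. if i = j then \<xi> $ i else 0)"

definition partial1 :: "((real^('n::finite)) \<times> (real^('s::finite)) \<times> (real^'s) \<Rightarrow> real^('m::finite))
    \<Rightarrow> real^'n \<Rightarrow> real^'s \<Rightarrow> real^'s \<Rightarrow> real^'n^'m" where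
  "partial1 c x a b = jacobian (\<lambda>u. c (u, a, b)) (at x)"

definition partial2 :: "((real^('n::finite)) \<times> (real^('s::finite)) \<times> (real^'s) \<Rightarrow> real^('m::finite))
    \<Rightarrow> real^'n \<Rightarrow> real^'s \<Rightarrow> real^'s \<Rightarrow> real^'s^'m" where
  "partial2 c x a b = jacobian (\<lambda>u. c (x, u, b)) (at a)"

definition partial3 :: "((real^('n::finite)) \<times> (real^('s::finite)) \<times> (real^'s) \<Rightarrow> real^('m::finite))
    \<Rightarrow> real^'n \<Rightarrow> real^'s \<Rightarrow> real^'s \<Rightarrow> real^'s^'m" where
  "partial3 c x a b = jacobian (\<lambda>u. c (x, a, u)) (at b)"

definition solution_operator ::
  "((real^('n::finite)) \<times> (real^('s::finite)) \<times> (real^'s) \<Rightarrow> real^'s) \<Rightarrow> real^'n \<Rightarrow> real^'s" where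
  "solution_operator c x = (THE z. z = c (x, \<bar>z\<bar>, z))"

definition evaluation_procedure ::
  "((real^('n::finite)) \<times> (real^('s::{finite,linorder})) \<times> (real^('s::{finite,linorder})) \<Rightarrow> real)
   \<Rightarrow> ((real^'n) \<times> (real^('s::{finite,linorder})) \<times> (real^('s::{finite,linorder})) \<Rightarrow> real^('s::{finite,linorder})) \<Rightarrow> (real^'n \<Rightarrow> real) \<Rightarrow> bool" where
  "evaluation_procedure f c \<phi> \<longleftrightarrow>
     C2 f \<and> C2 c \<and>
     (\<forall>x z. strictly_lower_triangular (partial2 c x \<bar>z\<bar> z) \<and>
            strictly_lower_triangular (partial3 c x \<bar>z\<bar> z)) \<and>
     (\<forall>x. \<phi> x = f (x, \<bar>solution_operator c x\<bar>, solution_operator c x))"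

text \<open>The modified switching equation may have further solutions away from the base point, so
  its solution operator is a local object: a continuous branch through \<open>z[x0]\<close>.
  At the base point the matrix \<open>\<partial>\<^sub>2 c \<Xi> + \<partial>\<^sub>3 c\<close> is strictly lower triangular for admissible
  \<open>\<xi>\<close>, so by the implicit function theorem such a branch exists, its germ at \<open>x0\<close> is unique,
  and it is of class \<open>C\<^sup>2\<close> near \<open>x0\<close>. The choice made by \<open>SOME\<close> therefore does not affect
  the value and the gradient of the smooth model at \<open>x0\<close>.\<close>

definition modified_solution ::
  "((real^('n::finite)) \<times> (real^('s::finite)) \<times> (real^'s) \<Rightarrow> real^'s) \<Rightarrow> real^'n \<Rightarrow> real^'s
   \<Rightarrow> (real^'n \<Rightarrow> real^'s) \<Rightarrow> bool" where
  "modified_solution c x0 \<xi> w \<longleftrightarrow>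
     w x0 = solution_operator c x0 \<and>
     (\<exists>U. open U \<and> x0 \<in> U \<and> continuous_on U w \<and>
          (\<forall>x\<in>U. w x = c (x, diag_mat \<xi> *v w x, w x)))"

definition modified_solution_operator ::
  "((real^('n::finite)) \<times> (real^('s::finite)) \<times> (real^'s) \<Rightarrow> real^'s) \<Rightarrow> real^'n \<Rightarrow> real^'s
   \<Rightarrow> real^'n \<Rightarrow> real^'s" where
  "modified_solution_operator c x0 \<xi> = (SOME w. modified_solution c x0 \<xi> w)"

definition smooth_model ::
  "((real^('n::finite)) \<times> (real^('s::finite)) \<times> (real^'s) \<Rightarrow> real)
   \<Rightarrow> ((real^'n) \<times> (real^'s) \<times> (real^'s) \<Rightarrow> real^'s) \<Rightarrow> real^'n \<Rightarrow> real^'s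
   \<Rightarrow> real^'n \<Rightarrow> real" where
  "smooth_model f c x0 \<xi> x =
     f (x, diag_mat \<xi> *v modified_solution_operator c x0 \<xi> x, modified_solution_operator c x0 \<xi> x)"

definition gradient :: "('a::real_inner \<Rightarrow> real) \<Rightarrow> 'a \<Rightarrow> 'a" where
  "gradient \<phi> x = (THE g. GDERIV \<phi> x :> g)"

definition limiting_gradients :: "('a::real_inner \<Rightarrow> real) \<Rightarrow> 'a \<Rightarrow> 'a set" where
  "limiting_gradients \<phi> x0 =
     {g. \<exists>X. X \<longlonglongrightarrow> x0 \<and> (\<forall>k::nat. \<phi> differentiable (at (X k))) \<and>
             (\<lambda>k. gradient \<phi> (X k)) \<longlonglongrightarrow> g}"

definition clarke_gradients :: "('a::real_inner \<Rightarrow> real) \<Rightarrow> 'a \<Rightarrow> 'a set" where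
  "clarke_gradients \<phi> x0 = convex hull (limiting_gradients \<phi> x0)"

definition fill_signs :: "real^('s::finite) \<Rightarrow> real^'s \<Rightarrow> real^'s" where
  "fill_signs \<sigma> \<zeta> = (\<chi> k. if \<sigma> $ k = 0 then \<zeta> $ k else \<sigma> $ k)"

end

theory Submission
  imports Defs
begin

text \<open>Strict triangularity makes the \<open>k\<close>-th component of \<open>c(x, \<bar>z\<bar>, z)\<close> depend only on the
  components of \<open>z\<close> below \<open>k\<close>, so the switching equation has a unique solution. The derivative
  \<open>y\<close> of the modified solution in direction \<open>d\<close> solves the triangular system
  \<open>y = Z d + A \<Xi> y + B y\<close>.

  For \<open>d = Z\<^sup>\<dagger> v\<close> the inhomogeneity is \<open>v\<close> for every \<open>j\<close>. Choosing \<open>v\<^sub>k = \<tau>\<^sub>k M\<^sub>k\<close> successively,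
  with \<open>M\<^sub>k\<close> larger than the contribution of the earlier components, gives all derivatives \<open>y\<close> the
  sign pattern \<open>\<tau>\<close>. Hence for small \<open>t > 0\<close> all smooth models for \<open>\<tau>\<close> coincide with the
  \<open>\<phi>\<^sup>[\<^sup>j\<^sup>]\<close> near \<open>x0 + t d\<close>, and the first claim follows by continuity of their gradients.

  Again by triangularity, \<open>y\<close> and \<open>\<Xi> y\<close> are affine in each component of \<open>\<xi>\<close>. So the averaged
  gradient is multi-affine in \<open>\<zeta>\<close>, and its values on the cube lie in the convex hull of its values
  at the vertices.\<close>

section \<open>Causal maps and triangular systems\<close>

lemma diag_mat_mult_nth [simp]: "(diag_mat \<xi> *v u) $ k = \<xi> $ k * u $ k"
  by (simp add: diag_mat_def matrix_vector_mult_def if_distrib[of "\<lambda>t. t * _"] cong: if_cong)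

text \<open>The number of predecessors drops strictly on passing to a smaller index and serves as
  the measure.\<close>

lemma finite_linorder_less_induct [case_names less]:
  fixes k :: "'s::{finite,linorder}"
  assumes "\<And>k. (\<And>i. i < k \<Longrightarrow> P i) \<Longrightarrow> P k"
  shows "P k"
proof (induction k rule: measure_induct_rule[where f = "\<lambda>k. card {i. i < k}"])
  case (less k)
  have "card {i'. i' < i} < card {i'. i' < k}" if "i < k" for i
    using that by (intro psubset_card_mono) auto
  then show ?case
    using assms less by blast
qed

text \<open>The nonlinear counterpart of strict lower triangularity; fixed points can be found by
  forward substitution.\<close>

definition causal :: "(real^('s::{finite,linorder}) \<Rightarrow> real^('s::{finite,linorder})) \<Rightarrow> bool" where
  "causal G \<longleftrightarrow> (\<forall>k y y'. (\<forall>i<k. y $ i = y' $ i) \<longrightarrow> G y $ k = G y' $ k)"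

lemma causalD: "causal G \<Longrightarrow> (\<And>i. i < k \<Longrightarrow> y $ i = y' $ i) \<Longrightarrow> G y $ k = G y' $ k"
  unfolding causal_def by blast

lemma causal_fixpoint_unique:
  fixes G :: "real^('s::{finite,linorder}) \<Rightarrow> real^('s::{finite,linorder})"
  assumes "causal G" "y = G y" "y' = G y'"
  shows "y = y'"
proof -
  have "y $ k = y' $ k" for k
  proof (induction k rule: finite_linorder_less_induct)
    case (less k)
    then have "G y $ k = G y' $ k"
      by (intro causalD[OF assms(1)]) simp
    then show ?case
      using assms(2,3) by metis
  qed
  then show ?thesis
    by (simp add: vec_eq_iff)
qed

text \<open>All maps share the inhomogeneity \<open>v\<close>. In forward substitution
  \<open>v $ k\<close> is chosen after the earlier components of every \<open>y j\<close>, so it can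
  outweigh the finitely many contributions \<open>G j (y j) $ k\<close>.\<close>

lemma causal_fixpoints_dominated:
  fixes G :: "'j \<Rightarrow> real^('s::{finite,linorder}) \<Rightarrow> real^('s::{finite,linorder})"
  assumes "finite JJ" and G: "\<And>j. j \<in> JJ \<Longrightarrow> causal (G j)"
    and \<tau>: "\<And>k. \<tau> $ k \<in> {-1, 1}"
  obtains v y where "\<And>j. j \<in> JJ \<Longrightarrow> y j = v + G j (y j)"
    and "\<And>j k. j \<in> JJ \<Longrightarrow> 0 < \<tau> $ k * y j $ k"
proof -
  have "\<exists>v y. \<forall>j\<in>JJ. \<forall>k\<in>S. y j $ k = v $ k + G j (y j) $ k \<and> 0 < \<tau> $ k * y j $ k"
    if "finite S" "\<forall>k\<in>S. \<forall>i<k. i \<in> S" for S :: "'s set"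
    using that
  proof (induction S rule: finite_linorder_max_induct)
    case empty
    then show ?case by simp
  next
    case (insert b S)
    have "\<forall>k\<in>S. \<forall>i<k. i \<in> S"
      using insert.prems insert.hyps by (metis insert_iff order.asym)
    from insert.IH[OF this] obtain v y where
      vy: "\<forall>j\<in>JJ. \<forall>k\<in>S. y j $ k = v $ k + G j (y j) $ k \<and> 0 < \<tau> $ k * y j $ k"
      by blast
    \<comment> \<open>As \<open>\<tau> $ b\<close> is 1 or -1, \<open>\<tau> $ b * y' j $ b\<close>
      is at least \<open>M - \<bar>G j (y j) $ b\<bar>\<close>, which is positive for all
      \<open>j\<close> in \<open>JJ\<close> simultaneously.\<close>
    define M where "M = 1 + (\<Sum>j\<in>JJ. \<bar>G j (y j) $ b\<bar>)"
    define v' where "v' = (\<chi> k. if k = b then \<tau> $ b * M else v $ k)"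
    define y' where "y' j = (\<chi> k. if k = b then \<tau> $ b * M + G j (y j) $ b else y j $ k)" for j
    have "y' j $ k = v' $ k + G j (y' j) $ k \<and> 0 < \<tau> $ k * y' j $ k"
      if "j \<in> JJ" "k \<in> insert b S" for j k
    proof -
      have "k \<le> b"
        using that insert.hyps by auto
      then have same: "G j (y' j) $ k = G j (y j) $ k"
        by (intro causalD[OF G[OF \<open>j \<in> JJ\<close>]]) (auto simp: y'_def)
      show ?thesis
      proof (cases "k = b")
        case True
        have "\<bar>G j (y j) $ b\<bar> < M"
          using member_le_sum[of j JJ "\<lambda>j. \<bar>G j (y j) $ b\<bar>"] that \<open>finite JJ\<close> by (simp add: M_def)
        moreover have "\<tau> $ b = 1 \<or> \<tau> $ b = -1"
          using \<tau> by auto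
        ultimately show ?thesis
          using True same by (auto simp: y'_def v'_def)
      next
        case False
        then have "y' j $ k = y j $ k" "v' $ k = v $ k"
          by (simp_all add: y'_def v'_def)
        then show ?thesis
          using vy that same False by (metis insert_iff)
      qed
    qed
    then show ?case by blast
  qed
  from this[of UNIV] obtain v y where
    vy: "\<forall>j\<in>JJ. \<forall>k. y j $ k = v $ k + G j (y j) $ k \<and> 0 < \<tau> $ k * y j $ k"
    by auto
  show ?thesis
  proof (rule that[of y v])
    show "y j = v + G j (y j)" if "j \<in> JJ" for j
      unfolding vec_eq_iff vector_add_component using vy that by blast
  qed (use vy in blast)
qed

text \<open>Forward substitution over down-closed index sets: overwriting component \<open>b\<close>
  does not disturb the equations up to \<open>b\<close>, none of which sees it.\<close>

lemma causal_fixpoint_exists: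
  fixes G :: "real^('s::{finite,linorder}) \<Rightarrow> real^('s::{finite,linorder})"
  assumes "causal G"
  shows "\<exists>y. y = G y"
proof -
  have "\<exists>y. \<forall>k\<in>S. y $ k = G y $ k"
    if "finite S" "\<forall>k\<in>S. \<forall>i<k. i \<in> S" for S :: "'s set"
    using that
  proof (induction S rule: finite_linorder_max_induct)
    case empty
    then show ?case by simp
  next
    case (insert b S)
    have "\<forall>k\<in>S. \<forall>i<k. i \<in> S"
      using insert.prems insert.hyps by (metis insert_iff order.asym)
    then obtain y where y: "\<forall>k\<in>S. y $ k = G y $ k"
      using insert.IH by blast
    define y' where "y' = (\<chi> k. if k = b then G y $ b else y $ k)"
    have "y' $ k = G y' $ k" if "k \<in> insert b S" for k
    proof -
      have "k \<le> b"
        using that insert.hyps by auto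
      then have "G y' $ k = G y $ k"
        by (intro causalD[OF assms]) (auto simp: y'_def)
      then show ?thesis
        using y that by (auto simp: y'_def)
    qed
    then show ?case by blast
  qed
  from this[of UNIV] show ?thesis
    by (auto simp: vec_eq_iff)
qed

lemma strictly_lower_triangular_causal:
  assumes "strictly_lower_triangular A" "\<And>i. i < k \<Longrightarrow> u $ i = u' $ i"
  shows "(A *v u) $ k = (A *v u') $ k"
proof -
  have "A $ k $ i * u $ i = A $ k $ i * u' $ i" for i
    using assms by (cases "i < k") (auto simp: strictly_lower_triangular_def)
  then show ?thesis
    by (simp only: matrix_vector_mult_def vec_lambda_beta)
qed

text \<open>\<^term>\<open>y\<close> is the derivative in direction \<^term>\<open>d\<close> of the solution of the modified
  switching equation, where \<^term>\<open>P\<close>, \<^term>\<open>A\<close>, \<^term>\<open>B\<close> are the partial derivatives of \<^term>\<open>c\<close>.\<close>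

definition tangent_solution ::
  "real^('n::finite)^('s::{finite,linorder}) \<Rightarrow> real^('s::{finite,linorder})^('s::{finite,linorder}) \<Rightarrow>
    real^('s::{finite,linorder})^('s::{finite,linorder}) \<Rightarrow> real^('s::{finite,linorder}) \<Rightarrow>
    real^'n \<Rightarrow> real^('s::{finite,linorder}) \<Rightarrow> bool"
  where "tangent_solution P A B \<xi> d y \<longleftrightarrow> y = P *v d + A *v (diag_mat \<xi> *v y) + B *v y"

text \<open>Scaling by \<open>diag_mat \<xi>\<close> acts componentwise, hence preserves agreement
  below \<open>k\<close>, which is all that row \<open>k\<close> of the matrices sees.\<close>

lemma causal_tangent_map:
  assumes "strictly_lower_triangular A" "strictly_lower_triangular B"
  shows "causal (\<lambda>y. p + A *v (diag_mat \<xi> *v y) + B *v y)"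
  unfolding causal_def vector_add_component
  by (auto intro!: arg_cong2[where f = "(+)"] strictly_lower_triangular_causal[OF assms(1)]
      strictly_lower_triangular_causal[OF assms(2)])

lemma tangent_solution_unique:
  assumes "strictly_lower_triangular A" "strictly_lower_triangular B"
    and "tangent_solution P A B \<xi> d y" "tangent_solution P A B \<xi> d y'"
  shows "y = y'"
  using causal_fixpoint_unique[OF causal_tangent_map[OF assms(1,2)]] assms(3,4)
  unfolding tangent_solution_def by blast

text \<open>Two solutions whose parameters differ only in the component \<^term>\<open>k\<close> agree up to that
  component, so the product of parameter and solution is affine along the segment between the
  parameters.\<close>

lemma tangent_solution_affine:
  fixes A B :: "real^('s::{finite,linorder})^('s::{finite,linorder})"
  assumes A: "strictly_lower_triangular A" and B: "strictly_lower_triangular B"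
    and y: "tangent_solution P A B \<xi> d y" and y': "tangent_solution P A B \<xi>' d y'"
    and agree: "\<And>i. i \<noteq> k \<Longrightarrow> \<xi> $ i = \<xi>' $ i"
    and "a + b = 1"
  shows "diag_mat (a *\<^sub>R \<xi> + b *\<^sub>R \<xi>') *v (a *\<^sub>R y + b *\<^sub>R y')
      = a *\<^sub>R (diag_mat \<xi> *v y) + b *\<^sub>R (diag_mat \<xi>' *v y')" (is ?prod)
    and "tangent_solution P A B (a *\<^sub>R \<xi> + b *\<^sub>R \<xi>') d (a *\<^sub>R y + b *\<^sub>R y')" (is ?sol)
proof -
  have b: "b = 1 - a"
    using \<open>a + b = 1\<close> by simp
  have "i \<le> k \<longrightarrow> y $ i = y' $ i" for i
  proof (induction i rule: finite_linorder_less_induct)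
    case (less i)
    show ?case
    proof
      assume "i \<le> k"
      then have "y $ l = y' $ l" "\<xi> $ l = \<xi>' $ l" if "l < i" for l
        using less agree that by auto
      then have "(A *v (diag_mat \<xi> *v y)) $ i = (A *v (diag_mat \<xi>' *v y')) $ i"
        "(B *v y) $ i = (B *v y') $ i"
        by (auto intro!: strictly_lower_triangular_causal A B)
      then show "y $ i = y' $ i"
        using y y' unfolding tangent_solution_def by (metis vector_add_component)
    qed
  qed
  then have yk: "y $ k = y' $ k" by simp
  \<comment> \<open>In component \<open>k\<close> the solution factor is common to both products, in
    every other component the parameter factor is.\<close>
  show prod: ?prod
  proof (subst vec_eq_iff, rule allI)
    fix i
    show "(diag_mat (a *\<^sub>R \<xi> + b *\<^sub>R \<xi>') *v (a *\<^sub>R y + b *\<^sub>R y')) $ i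
      = (a *\<^sub>R (diag_mat \<xi> *v y) + b *\<^sub>R (diag_mat \<xi>' *v y')) $ i"
      using yk agree[of i] by (cases "i = k") (auto simp: b algebra_simps)
  qed
  have "a *\<^sub>R y + b *\<^sub>R y' = a *\<^sub>R (P *v d + A *v (diag_mat \<xi> *v y) + B *v y)
      + b *\<^sub>R (P *v d + A *v (diag_mat \<xi>' *v y') + B *v y')"
    using y y' unfolding tangent_solution_def by metis
  also have "\<dots> = P *v d + A *v (a *\<^sub>R (diag_mat \<xi> *v y) + b *\<^sub>R (diag_mat \<xi>' *v y'))
      + B *v (a *\<^sub>R y + b *\<^sub>R y')"
    by (simp add: b algebra_simps matrix_vector_right_distrib matrix_vector_mult_scaleR)
  finally show ?sol
    unfolding tangent_solution_def prod .
qed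

text \<open>Induction on the number of coordinates other than -1 and 1: splitting at one of them
  gives a convex combination of two values with fewer such coordinates.\<close>

lemma multi_affine_in_vertex_hull:
  fixes H :: "real^('s::finite) \<Rightarrow> 'b::real_vector"
  assumes split: "\<And>\<zeta> k. (\<And>i. \<zeta> $ i \<in> {-1..1}) \<Longrightarrow>
      H \<zeta> = ((1 + \<zeta> $ k) / 2) *\<^sub>R H (\<chi> i. if i = k then 1 else \<zeta> $ i)
          + ((1 - \<zeta> $ k) / 2) *\<^sub>R H (\<chi> i. if i = k then -1 else \<zeta> $ i)"
    and "\<And>i. \<zeta> $ i \<in> {-1..1}"
  shows "H \<zeta> \<in> convex hull (H ` {\<tau>. \<forall>i. \<tau> $ i \<in> {-1, 1}})"
  using assms(2)
proof (induction \<zeta> rule: measure_induct_rule[where f = "\<lambda>\<zeta>. card {i. \<zeta> $ i \<notin> {-1, 1}}"])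
  case (less \<zeta>)
  show ?case
  proof (cases "\<forall>i. \<zeta> $ i \<in> {-1, 1}")
    case True
    then show ?thesis by (intro hull_inc) auto
  next
    case False
    then obtain k where k: "\<zeta> $ k \<notin> {-1, 1}" by blast
    have IH: "H (\<chi> i. if i = k then e else \<zeta> $ i) \<in> convex hull (H ` {\<tau>. \<forall>i. \<tau> $ i \<in> {-1, 1}})"
      if e: "e \<in> {-1, 1}" for e
    proof (rule less.IH)
      show "card {i. (\<chi> i. if i = k then e else \<zeta> $ i) $ i \<notin> {- 1, 1}} < card {i. \<zeta> $ i \<notin> {- 1, 1}}"
        using k e by (intro psubset_card_mono) (auto split: if_splits)
    qed (use less.prems e in auto)
    show ?thesis
      unfolding split[OF less.prems, where k = k] using less.prems[of k]
      by (intro convexD[OF convex_convex_hull] IH) (auto simp: field_simps)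
  qed
qed

section \<open>The switching equation\<close>

text \<open>Links the Jacobians of the partial maps to the full derivative by the chain rule along
  the three embeddings.\<close>

lemma partial_derivatives:
  fixes c :: "(real^'n) \<times> (real^'s) \<times> (real^'s) \<Rightarrow> real^'m"
  assumes der: "(c has_derivative c') (at (x, a, b))"
  shows "partial1 c x a b *v d = c' (d, 0, 0)"
    and "partial2 c x a b *v u = c' (0, u, 0)"
    and "partial3 c x a b *v v = c' (0, 0, v)"
    and "c' (d, u, v) = partial1 c x a b *v d + partial2 c x a b *v u + partial3 c x a b *v v"
proof -
  have lin: "linear c'"
    using der by (rule has_derivative_linear)
  have chain: "((\<lambda>t. c (g t)) has_derivative (\<lambda>t. c' (g' t))) (at t0)"
    if "(g has_derivative g') (at t0)" "g t0 = (x, a, b)" for g g' and t0 :: "'c::real_normed_vector"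
    using has_derivative_compose[OF that(1), of c c'] der that(2) by simp
  have jac: "jacobian g (at t0) *v t = g' t"
    if "(g has_derivative g') (at t0)" for g g' and t0 t :: "real^'k"
    using that by (simp add: jacobian_def frechet_derivative_at[OF that, symmetric]
        matrix_works has_derivative_linear)
  show 1: "partial1 c x a b *v d = c' (d, 0, 0)"
    unfolding partial1_def by (rule jac, rule chain) (auto intro!: derivative_eq_intros simp: zero_prod_def)
  show 2: "partial2 c x a b *v u = c' (0, u, 0)"
    unfolding partial2_def by (rule jac, rule chain) (auto intro!: derivative_eq_intros)
  show 3: "partial3 c x a b *v v = c' (0, 0, v)"
    unfolding partial3_def by (rule jac, rule chain) (auto intro!: derivative_eq_intros)
  have "c' (d, u, v) = c' ((d, 0, 0) + (0, u, 0) + (0, 0, v))"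
    by simp
  then show "c' (d, u, v) = partial1 c x a b *v d + partial2 c x a b *v u + partial3 c x a b *v v"
    unfolding 1 2 3 linear_add[OF lin, symmetric] by simp
qed

text \<open>A component that vanishes at \<open>t\<close> is required to be constant; every other
  one is away from the kink of the absolute value.\<close>

lemma has_derivative_abs_segment:
  fixes z w :: "real^'s"
  assumes "\<And>i. z $ i + t * w $ i = 0 \<Longrightarrow> w $ i = 0"
  shows "((\<lambda>t. \<bar>z + t *\<^sub>R w\<bar>) has_derivative (\<lambda>h. h *\<^sub>R (\<chi> i. sgn (z $ i + t * w $ i) * w $ i))) (at t)"
proof -
  have "((\<lambda>t. \<bar>z $ i + t * w $ i\<bar>) has_derivative (\<lambda>h. h * (sgn (z $ i + t * w $ i) * w $ i))) (at t)" for i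
  proof (cases "w $ i = 0")
    case False
    then have "z $ i + t * w $ i \<noteq> 0"
      using assms by blast
    moreover have "((\<lambda>t. z $ i + t * w $ i) has_derivative (\<lambda>h. h * w $ i)) (at t)"
      by (auto intro!: derivative_eq_intros)
    ultimately have "((\<lambda>t. norm (z $ i + t * w $ i)) has_derivative
        (\<lambda>h. (h * w $ i) \<bullet> sgn (z $ i + t * w $ i))) (at t)"
      by (intro has_derivative_compose[OF _ has_derivative_norm])
    then show ?thesis by (simp add: mult_ac)
  qed simp
  then show ?thesis
    by (subst has_derivative_componentwise_within)
      (auto simp: Basis_vec_def inner_axis abs_vec_def)
qed

text \<open>Triangularity is only assumed at the points \<^term>\<open>(x, \<bar>z\<bar>, z)\<close>. The segment between two
  arguments that agree below \<^term>\<open>k\<close> yields a path through such points, which is differentiable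
  up to finitely many parameters, and along which component \<^term>\<open>k\<close> of \<^term>\<open>c\<close> has derivative 0.\<close>

lemma causal_switching_map:
  fixes c :: "(real^'n) \<times> (real^('s::{finite,linorder})) \<times> (real^('s::{finite,linorder}))
    \<Rightarrow> real^('s::{finite,linorder})"
  assumes der: "\<And>p. (c has_derivative c' p) (at p)"
    and slt: "\<And>z. strictly_lower_triangular (partial2 c x \<bar>z\<bar> z)"
      "\<And>z. strictly_lower_triangular (partial3 c x \<bar>z\<bar> z)"
  shows "causal (\<lambda>z. c (x, \<bar>z\<bar>, z))"
  unfolding causal_def
proof (intro allI impI)
  fix k and y y' :: "real^('s::{finite,linorder})"
  assume agree: "\<forall>i<k. y $ i = y' $ i"
  define w where "w = y' - y"
  have w: "w $ i = 0" if "i < k" for i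
    using agree that by (simp add: w_def)
  define p where "p t = (x, \<bar>y + t *\<^sub>R w\<bar>, y + t *\<^sub>R w)" for t :: real
  \<comment> \<open>The parameters at which a moving component vanishes. For
    \<open>w $ i = 0\<close> the quotient is 0 by convention, a harmless extra exception.\<close>
  define S where "S = (\<lambda>i. - (y $ i) / w $ i) ` UNIV"
  have cont_abs: "continuous_on UNIV (\<lambda>t. \<bar>y + t *\<^sub>R w\<bar>)"
    unfolding abs_vec_def by (intro continuous_intros)
  have cont_c: "continuous_on UNIV c"
    by (intro continuous_at_imp_continuous_on ballI has_derivative_continuous[OF der])
  have cont: "continuous_on {0..1} (\<lambda>t. c (p t) $ k)"
    unfolding p_def
    by (intro continuous_intros continuous_on_compose2[OF cont_c]
        continuous_on_subset[OF cont_abs]) auto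
  have deriv: "((\<lambda>t. c (p t) $ k) has_derivative (\<lambda>h. 0)) (at t within {0..1})" if "t \<notin> S" for t
  proof -
    define u where "u = (\<chi> i. sgn (y $ i + t * w $ i) * w $ i)"
    have "w $ i = 0" if "y $ i + t * w $ i = 0" for i
    proof (rule ccontr)
      assume "w $ i \<noteq> 0"
      then have "t = - (y $ i) / w $ i"
        using that by (simp add: field_simps)
      then show False
        using \<open>t \<notin> S\<close> by (auto simp: S_def)
    qed
    then have "((\<lambda>t. \<bar>y + t *\<^sub>R w\<bar>) has_derivative (\<lambda>h. h *\<^sub>R u)) (at t)"
      unfolding u_def by (rule has_derivative_abs_segment)
    then have "(p has_derivative (\<lambda>h. (0, h *\<^sub>R u, h *\<^sub>R w))) (at t)"
      unfolding p_def by (auto intro!: derivative_eq_intros)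
    then have "((\<lambda>t. c (p t) $ k) has_derivative (\<lambda>h. c' (p t) (0, h *\<^sub>R u, h *\<^sub>R w) $ k)) (at t)"
      by (intro bounded_linear.has_derivative[OF bounded_linear_vec_nth] has_derivative_compose[OF _ der])
    moreover have "c' (p t) (0, h *\<^sub>R u, h *\<^sub>R w) $ k = 0" for h
    proof -
      have "(partial2 c x \<bar>y + t *\<^sub>R w\<bar> (y + t *\<^sub>R w) *v (h *\<^sub>R u)) $ k = 0"
        using strictly_lower_triangular_causal[OF slt(1), of k "h *\<^sub>R u" 0] w by (simp add: u_def)
      moreover have "(partial3 c x \<bar>y + t *\<^sub>R w\<bar> (y + t *\<^sub>R w) *v (h *\<^sub>R w)) $ k = 0"
        using strictly_lower_triangular_causal[OF slt(2), of k "h *\<^sub>R w" 0] w by simp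
      ultimately show ?thesis
        unfolding p_def partial_derivatives(4)[OF der] by simp
    qed
    ultimately show ?thesis
      using has_derivative_at_withinI by fastforce
  qed
  \<comment> \<open>A continuous function with derivative 0 off a finite set is constant.\<close>
  have "c (p 1) $ k = c (p 0) $ k"
    by (rule has_derivative_zero_unique_strong_interval[of S 0 1 "\<lambda>t. c (p t) $ k"])
      (use cont deriv in \<open>auto simp: S_def\<close>)
  then show "c (x, \<bar>y\<bar>, y) $ k = c (x, \<bar>y'\<bar>, y') $ k"
    by (simp add: p_def w_def)
qed

lemma solution_operator_eqI:
  fixes c :: "(real^'n) \<times> (real^('s::{finite,linorder})) \<times> (real^('s::{finite,linorder}))
    \<Rightarrow> real^('s::{finite,linorder})"
  assumes "causal (\<lambda>z. c (x, \<bar>z\<bar>, z))" "z = c (x, \<bar>z\<bar>, z)"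
  shows "solution_operator c x = z"
  unfolding solution_operator_def
proof (rule the_equality)
  show "z = c (x, \<bar>z\<bar>, z)"
    by (rule assms(2))
  show "z' = z" if "z' = c (x, \<bar>z'\<bar>, z')" for z'
    using causal_fixpoint_unique[OF assms(1) that assms(2)] .
qed

lemma solution_operator_solves:
  fixes c :: "(real^'n) \<times> (real^('s::{finite,linorder})) \<times> (real^('s::{finite,linorder}))
    \<Rightarrow> real^('s::{finite,linorder})"
  assumes "causal (\<lambda>z. c (x, \<bar>z\<bar>, z))"
  shows "solution_operator c x = c (x, \<bar>solution_operator c x\<bar>, solution_operator c x)"
proof -
  obtain z where "z = c (x, \<bar>z\<bar>, z)"
    using causal_fixpoint_exists[OF assms] by blast
  then show ?thesis
    using solution_operator_eqI[OF assms, of z] by metis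
qed

section \<open>Perturbed linear equations and gradients\<close>

text \<open>The left inverse gives \<open>u x - u0 = N ((M0 - M x) (u x))\<close>, and for
  \<open>M x\<close> close to \<open>M0\<close> the part with \<open>u x - u0\<close> is absorbed on
  the left. This serves to show that the derivative of an implicit function is continuous.\<close>

lemma tendsto_linear_solution:
  fixes M :: "'x \<Rightarrow> 'a::real_normed_vector \<Rightarrow>\<^sub>L 'b::real_normed_vector"
  assumes M: "(M \<longlongrightarrow> M0) F" and inv: "N o\<^sub>L M0 = id_blinfun"
    and u: "\<forall>\<^sub>F x in F. M x (u x) = M0 u0"
  shows "(u \<longlongrightarrow> u0) F"
proof -
  define \<delta> where "\<delta> x = norm N * norm (M0 - M x)" for x
  have "((\<lambda>x. norm N * norm (M0 - M x)) \<longlongrightarrow> norm N * norm (M0 - M0)) F"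
    by (intro tendsto_intros M)
  then have \<delta>: "(\<delta> \<longlongrightarrow> 0) F"
    by (simp add: \<delta>_def[abs_def])
  have "\<forall>\<^sub>F x in F. \<delta> x < 1 / 2"
    using \<delta> by (rule order_tendstoD) simp
  with u have "\<forall>\<^sub>F x in F. norm (u x - u0) \<le> 2 * \<delta> x * norm u0"
  proof eventually_elim
    case (elim x)
    have N: "N (M0 v) = v" for v
      using inv by (metis blinfun_apply_blinfun_compose blinfun_apply_id_blinfun)
    have "u x - u0 = N (M0 (u x) - M0 u0)"
      by (simp add: blinfun.diff_right N)
    also have "\<dots> = N ((M0 - M x) (u x))"
      using elim by (simp add: blinfun.diff_left)
    finally have "norm (u x - u0) \<le> norm N * (norm (M0 - M x) * norm (u x))"
      using order_trans[OF norm_blinfun mult_left_mono[OF norm_blinfun norm_ge_zero]] by metis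
    also have "\<dots> \<le> \<delta> x * (norm (u x - u0) + norm u0)"
      using norm_triangle_ineq[of "u x - u0" u0]
      by (simp add: \<delta>_def mult_left_mono mult.assoc)
    also have "\<dots> \<le> norm (u x - u0) / 2 + \<delta> x * norm u0"
      using elim mult_right_mono[of "\<delta> x" "1/2" "norm (u x - u0)"] by (simp add: algebra_simps)
    finally show ?case by simp
  qed
  moreover have "((\<lambda>x. 2 * \<delta> x * norm u0) \<longlongrightarrow> 2 * 0 * norm u0) F"
    by (intro tendsto_intros \<delta>)
  ultimately have "((\<lambda>x. u x - u0) \<longlongrightarrow> 0) F"
    using Lim_null_comparison by fastforce
  then show ?thesis
    by (rule LIM_zero_cancel)
qed

text \<open>The values of \<open>D\<close> on the basis give its representing vector; uniqueness of
  derivatives makes the description in \<open>gradient\<close> denote it.\<close>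

lemma gradient_inner:
  assumes "(\<phi> has_derivative D) (at (x::'a::euclidean_space))"
  shows "gradient \<phi> x \<bullet> d = D d"
proof -
  have lin: "linear D"
    using assms by (rule has_derivative_linear)
  define g where "g = (\<Sum>b\<in>Basis. D b *\<^sub>R b)"
  have g: "v \<bullet> g = D v" for v
  proof -
    have "v \<bullet> g = (\<Sum>b\<in>Basis. (v \<bullet> b) *\<^sub>R D b)"
      by (simp add: g_def inner_sum_right mult.commute)
    also have "\<dots> = D (\<Sum>b\<in>Basis. (v \<bullet> b) *\<^sub>R b)"
      by (simp only: linear_sum[OF lin] linear_scale[OF lin])
    finally show ?thesis
      by (simp only: euclidean_representation)
  qed
  have "gradient \<phi> x = g"
    unfolding gradient_def
  proof (rule the_equality)
    show "GDERIV \<phi> x :> g"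
      using assms by (simp add: gderiv_def g)
    show "g' = g" if "GDERIV \<phi> x :> g'" for g'
      using has_derivative_unique[OF assms, of "\<lambda>h. h \<bullet> g'"] that
      by (intro vector_eq_ldot[THEN iffD1]) (simp add: gderiv_def g fun_eq_iff)
  qed
  then show ?thesis
    by (simp add: inner_commute g)
qed

section \<open>Smooth models\<close>

text \<open>The implicit function theorem, obtained by inverting the map that sends
  \<open>(x, z)\<close> to \<open>(x, z - c (x, diag_mat \<xi> *v z, z))\<close> near
  \<open>(x0, z0)\<close>. The conclusion is about the branch selected by \<open>SOME\<close>, not
  just the one constructed.\<close>

lemma modified_solution_branch:
  fixes c :: "(real^'n) \<times> (real^('s::{finite,linorder})) \<times> (real^('s::{finite,linorder}))
    \<Rightarrow> real^('s::{finite,linorder})"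
    and c' :: "_ \<Rightarrow> _ \<Rightarrow>\<^sub>L _"
  assumes der: "\<And>p. (c has_derivative blinfun_apply (c' p)) (at p)"
    and cont: "continuous_on UNIV c'"
    and slt: "strictly_lower_triangular (partial2 c x0 (diag_mat \<xi> *v z0) z0)"
      "strictly_lower_triangular (partial3 c x0 (diag_mat \<xi> *v z0) z0)"
    and z0: "solution_operator c x0 = z0" "z0 = c (x0, diag_mat \<xi> *v z0, z0)"
  defines "w \<equiv> modified_solution_operator c x0 \<xi>"
  obtains W Y where "open W" "x0 \<in> W" "w x0 = z0"
    and "\<And>x. x \<in> W \<Longrightarrow> w x = c (x, diag_mat \<xi> *v w x, w x)"
    and "\<And>x. x \<in> W \<Longrightarrow> (w has_derivative Y x) (at x)"
    and "\<And>x d. x \<in> W \<Longrightarrow> Y x d = c' (x, diag_mat \<xi> *v w x, w x) (d, diag_mat \<xi> *v Y x d, Y x d)"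
    and "\<And>d. isCont (\<lambda>x. Y x d) x0"
proof -
  \<comment> \<open>With \<open>K\<close> and \<open>E\<close> bounded linear, \<open>G\<close> and
    \<open>G'\<close> are built from \<open>c\<close> and \<open>c'\<close> by composition, so
    \<open>G'\<close> inherits continuity from \<open>c'\<close>.\<close>
  define K :: "((real^'n) \<times> (real^('s::{finite,linorder}))) \<Rightarrow>\<^sub>L
      ((real^'n) \<times> (real^('s::{finite,linorder})) \<times> (real^('s::{finite,linorder})))"
    where "K = Blinfun (\<lambda>q. (fst q, diag_mat \<xi> *v snd q, snd q))"
  define E :: "(real^('s::{finite,linorder})) \<Rightarrow>\<^sub>L ((real^'n) \<times> (real^('s::{finite,linorder})))"
    where "E = Blinfun (\<lambda>z. (0, z))"
  have K: "K q = (fst q, diag_mat \<xi> *v snd q, snd q)" for q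
    unfolding K_def
    by (subst bounded_linear_Blinfun_apply)
      (auto intro!: bounded_linear_Pair bounded_linear_fst bounded_linear_snd
        bounded_linear_compose[OF matrix_vector_mul_bounded_linear bounded_linear_snd])
  have E: "E z = (0, z)" for z
    unfolding E_def
    by (subst bounded_linear_Blinfun_apply)
      (auto intro!: bounded_linear_Pair bounded_linear_ident bounded_linear_zero)
  define G where "G q = q - E (c (K q))" for q
  define G' where "G' q = id_blinfun - (E o\<^sub>L c' (K q) o\<^sub>L K)" for q
  have G: "G (x, z) = (x, z - c (x, diag_mat \<xi> *v z, z))" for x z
    by (simp add: G_def E K)
  have G': "G' (x, z) (d, y) = (d, y - c' (x, diag_mat \<xi> *v z, z) (d, diag_mat \<xi> *v y, y))" for x z d y
    by (simp add: G'_def E K blinfun.diff_left)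
  have derG: "(G has_derivative G' q) (at q)" for q
  proof -
    have "((\<lambda>q. q - E (c (K q))) has_derivative (\<lambda>h. h - E (c' (K q) (K h)))) (at q)"
      by (intro derivative_intros bounded_linear.has_derivative[OF blinfun.bounded_linear_right]
          has_derivative_compose[OF _ der])
    moreover have "blinfun_apply (G' q) = (\<lambda>h. h - E (c' (K q) (K h)))"
      by (simp add: G'_def blinfun.diff_left fun_eq_iff)
    ultimately show ?thesis
      by (simp add: G_def[abs_def])
  qed
  have contG': "continuous_on UNIV G'"
    unfolding G'_def
    by (intro continuous_intros continuous_on_compose2[OF cont]
        bounded_bilinear.continuous_on[OF bounded_bilinear_blinfun_compose]) auto
  \<comment> \<open>A kernel element has \<open>d = 0\<close>, and its second part solves the
    homogeneous triangular system, whose only solution is 0.\<close>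
  have inj: "inj (blinfun_apply (G' (x0, z0)))"
  proof (subst linear_inj_iff_eq_0[OF bounded_linear.linear[OF blinfun.bounded_linear_right]], intro allI impI)
    fix q assume q: "G' (x0, z0) q = 0"
    obtain d y where dy: "q = (d, y)" by (cases q)
    let ?P = "partial1 c x0 (diag_mat \<xi> *v z0) z0" and ?A = "partial2 c x0 (diag_mat \<xi> *v z0) z0"
      and ?B = "partial3 c x0 (diag_mat \<xi> *v z0) z0"
    have "d = 0" "y = c' (x0, diag_mat \<xi> *v z0, z0) (d, diag_mat \<xi> *v y, y)"
      using q unfolding dy G' by (auto simp: zero_prod_def)
    then have "tangent_solution ?P ?A ?B \<xi> 0 y"
      unfolding tangent_solution_def partial_derivatives(4)[OF der, symmetric] by simp
    moreover have "tangent_solution ?P ?A ?B \<xi> 0 0"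
      by (simp add: tangent_solution_def)
    ultimately have "y = 0"
      by (rule tangent_solution_unique[OF slt])
    then show "q = 0"
      using \<open>d = 0\<close> by (simp add: dy zero_prod_def)
  qed
  obtain N where "linear N" "N \<circ> blinfun_apply (G' (x0, z0)) = id"
    using linear_injective_left_inverse[OF bounded_linear.linear[OF blinfun.bounded_linear_right] inj] by blast
  moreover from this have "N (G' (x0, z0) q) = q" for q
    by (metis comp_apply id_apply)
  ultimately have N: "Blinfun N o\<^sub>L G' (x0, z0) = id_blinfun"
    by (intro blinfun_eqI)
      (simp add: bounded_linear_Blinfun_apply linear_conv_bounded_linear)
  obtain U V g g' where UV: "open U" "(x0, z0) \<in> U" "open V" "G (x0, z0) \<in> V"
    and hom: "homeomorphism U V G g"
    and g: "\<And>q. q \<in> V \<Longrightarrow> (g has_derivative g' q) (at q)"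
    and g': "\<And>q. q \<in> V \<Longrightarrow> g' q = inv (blinfun_apply (G' (g q)))"
    and bij: "\<And>q. q \<in> V \<Longrightarrow> bij (blinfun_apply (G' (g q)))"
    apply (rule inverse_function_theorem[OF open_UNIV derG contG' UNIV_I N])
    subgoal premises prems for U V g g'
      using prems(2,4-10) by (rule prems(1))
    done
  have G0: "G (x0, z0) = (x0, 0)"
    unfolding G z0(2)[symmetric] by simp
  have g_in: "g q \<in> U" "G (g q) = q" if "q \<in> V" for q
    using hom that unfolding homeomorphism_def by auto
  have g_eq: "g (G q) = q" if "q \<in> U" for q
    using hom that unfolding homeomorphism_def by auto
  define h where "h x = snd (g (x, 0))" for x
  have gh: "g (x, 0) = (x, h x)" and h: "h x = c (x, diag_mat \<xi> *v h x, h x)" if "(x, 0) \<in> V" for x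
  proof -
    have "G (fst (g (x, 0)), h x) = (x, 0)"
      using g_in(2)[OF that] by (simp add: h_def)
    then have "fst (g (x, 0)) = x" "h x - c (x, diag_mat \<xi> *v h x, h x) = 0"
      unfolding G by auto
    then show "g (x, 0) = (x, h x)" "h x = c (x, diag_mat \<xi> *v h x, h x)"
      by (simp_all add: h_def prod_eq_iff)
  qed
  have pre_open: "open {x. (x, 0) \<in> V}"
    using open_vimage[OF UV(3), of "\<lambda>x. (x, 0)"] by (simp add: vimage_def continuous_on_Pair continuous_on_id continuous_on_const)
  have g_0: "g (x0, 0) = (x0, z0)"
    using g_eq[OF UV(2)] by (simp add: G0)
  have "continuous_on {x. (x, 0) \<in> V} h"
    unfolding h_def using homeomorphism_cont2[OF hom]
    by (intro continuous_on_snd, elim continuous_on_compose2)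
      (auto simp: continuous_on_Pair continuous_on_id continuous_on_const)
  \<comment> \<open>A branch exists, so \<open>SOME\<close> selects one as well, a priori different
    from \<open>h\<close>.\<close>
  then have "modified_solution c x0 \<xi> h"
    unfolding modified_solution_def using pre_open UV(4)
    by (intro conjI exI[of _ "{x. (x, 0) \<in> V}"] ballI h) (auto simp: h_def G0 g_0 z0(1))
  then have "modified_solution c x0 \<xi> w"
    unfolding w_def modified_solution_operator_def by (rule someI[of "modified_solution c x0 \<xi>"])
  then obtain T where w0: "w x0 = z0" and T: "open T" "x0 \<in> T" "continuous_on T w"
    and w: "\<And>x. x \<in> T \<Longrightarrow> w x = c (x, diag_mat \<xi> *v w x, w x)"
    unfolding modified_solution_def z0(1) by blast
  \<comment> \<open>For \<open>x\<close> in \<open>W\<close> both \<open>(x, w x)\<close> and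
    \<open>(x, h x)\<close> lie in \<open>U\<close>, where \<open>G\<close> is injective, and are
    mapped to \<open>(x, 0)\<close>; so \<open>w\<close> and \<open>h\<close> agree on
    \<open>W\<close>.\<close>
  define W where "W = {x \<in> T. (x, w x) \<in> U} \<inter> {x. (x, 0) \<in> V}"
  have "open {x \<in> T. (x, w x) \<in> U}"
    using continuous_open_preimage[of T "\<lambda>x. (x, w x)" U] T UV(1)
    by (simp add: vimage_def Int_def continuous_on_Pair continuous_on_id)
  then have W: "open W" "x0 \<in> W"
    using pre_open T(2) w0 UV(2) UV(4) by (auto simp: W_def G0)
  have wh: "w x = h x" if "x \<in> W" for x
  proof -
    have "G (x, w x) = (x, 0)"
      unfolding G using w[of x] that by (metis (mono_tags, lifting) IntE W_def diff_self mem_Collect_eq)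
    then show ?thesis
      using g_eq[of "(x, w x)"] that by (simp add: W_def h_def)
  qed
  define Y where "Y x d = snd (g' (x, 0) (d, 0))" for x d
  have G'g': "G' (x, w x) (g' (x, 0) (d, 0)) = (d, 0)" if "x \<in> W" for x d
  proof -
    have V: "(x, 0) \<in> V"
      using that by (simp add: W_def)
    show ?thesis
      using bij[OF V] unfolding g'[OF V] gh[OF V] wh[OF that]
      by (simp add: bij_is_surj surj_f_inv_f)
  qed
  show ?thesis
  proof (rule that[OF W w0])
    fix x assume x: "x \<in> W"
    then have V: "(x, 0) \<in> V"
      by (simp add: W_def)
    show "w x = c (x, diag_mat \<xi> *v w x, w x)"
      by (rule w) (use x in \<open>simp add: W_def\<close>)
    have "((\<lambda>x. (x, 0)) has_derivative (\<lambda>d. (d, 0))) (at x)"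
      by (auto intro!: derivative_eq_intros simp: zero_prod_def)
    then have "((\<lambda>x. g (x, 0)) has_derivative (\<lambda>d. g' (x, 0) (d, 0))) (at x)"
      by (rule has_derivative_compose) (rule g[OF V])
    then have "(h has_derivative Y x) (at x)"
      unfolding h_def Y_def by (rule has_derivative_snd)
    then show "(w has_derivative Y x) (at x)"
      by (rule has_derivative_transform_within_open[OF _ W(1) x]) (simp add: wh)
    show "Y x d = c' (x, diag_mat \<xi> *v w x, w x) (d, diag_mat \<xi> *v Y x d, Y x d)" for d
    proof -
      have "G' (x, w x) (fst (g' (x, 0) (d, 0)), Y x d) = (d, 0)"
        using G'g'[OF x, of d] by (simp add: Y_def)
      then show ?thesis
        unfolding G' by auto
    qed
  next
    fix d
    \<comment> \<open>The vector \<open>g' (x, 0) (d, 0)\<close> solves a linear equation whose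
      operator \<open>G' (x, w x)\<close> is continuous at \<open>x0\<close> and whose right-hand
      side \<open>(d, 0)\<close> is fixed.\<close>
    have "isCont (\<lambda>x. (x, w x)) x0"
      using T by (intro continuous_intros) (simp add: continuous_on_eq_continuous_at)
    moreover have "isCont G' (x0, w x0)"
      using contG' by (simp add: continuous_on_eq_continuous_at)
    ultimately have "isCont (\<lambda>x. G' (x, w x)) x0"
      by (rule isCont_o2)
    then have "((\<lambda>x. G' (x, w x)) \<longlongrightarrow> G' (x0, z0)) (at x0)"
      by (simp add: isCont_def w0)
    moreover have "\<forall>\<^sub>F x in at x0. x \<in> W"
      using W by (rule eventually_at_in_open')
    then have "\<forall>\<^sub>F x in at x0. G' (x, w x) (g' (x, 0) (d, 0)) = G' (x0, z0) (g' (x0, 0) (d, 0))"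
      by eventually_elim (use G'g'[OF W(2)] G'g' w0 in simp)
    ultimately have "((\<lambda>x. g' (x, 0) (d, 0)) \<longlongrightarrow> g' (x0, 0) (d, 0)) (at x0)"
      by (rule tendsto_linear_solution[OF _ N])
    then show "isCont (\<lambda>x. Y x d) x0"
      unfolding Y_def isCont_def by (rule tendsto_snd)
  qed
qed

lemma fill_signs_nth [simp]: "fill_signs \<sigma> \<zeta> $ k = (if \<sigma> $ k = 0 then \<zeta> $ k else \<sigma> $ k)"
  by (simp add: fill_signs_def)

lemma fill_signs_admissible: "diag_mat (fill_signs (sign_vec z) \<zeta>) *v z = \<bar>z\<bar>"
  by (auto simp: vec_eq_iff sign_vec_def abs_vec_def sgn_if)

text \<open>Either \<open>g 0\<close> is positive and continuity suffices, or it is 0 and the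
  positive slope decides. Used for the sign of a switching variable along a ray.\<close>

lemma eventually_pos_at_right:
  fixes g :: "real \<Rightarrow> real"
  assumes "(g has_real_derivative l) (at 0)" "0 \<le> g 0" "g 0 = 0 \<Longrightarrow> 0 < l"
  shows "\<forall>\<^sub>F t in at_right 0. 0 < g t"
proof (cases "g 0 = 0")
  case True
  then obtain e where "0 < e" "\<And>h. 0 < h \<Longrightarrow> h < e \<Longrightarrow> g 0 < g (0 + h)"
    using DERIV_pos_inc_right[OF assms(1)] assms(3) by blast
  then show ?thesis
    using True by (auto simp: eventually_at_right_field intro!: exI[of _ e])
next
  case False
  then have "0 < g 0"
    using assms(2) by simp
  then have "\<forall>\<^sub>F t in at 0. 0 < g t"
    using DERIV_isCont[OF assms(1)] by (auto simp: isCont_def intro: order_tendstoD)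
  then show ?thesis
    by (rule filter_leD[OF at_le, rotated]) simp
qed

section \<open>A single evaluation procedure with named derivatives\<close>

locale switching_system =
  fixes f :: "(real^'n) \<times> (real^('s::{finite,linorder})) \<times> (real^('s::{finite,linorder})) \<Rightarrow> real"
    and c :: "(real^'n) \<times> (real^('s::{finite,linorder})) \<times> (real^('s::{finite,linorder}))
      \<Rightarrow> real^('s::{finite,linorder})"
    and f' :: "_ \<Rightarrow> _ \<Rightarrow>\<^sub>L _" and c' :: "_ \<Rightarrow> _ \<Rightarrow>\<^sub>L _"
    and \<phi> :: "real^'n \<Rightarrow> real"
  assumes der_f: "\<And>p. (f has_derivative blinfun_apply (f' p)) (at p)"
    and cont_f': "continuous_on UNIV f'"
    and der_c: "\<And>p. (c has_derivative blinfun_apply (c' p)) (at p)"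
    and cont_c': "continuous_on UNIV c'"
    and slt2: "\<And>x z. strictly_lower_triangular (partial2 c x \<bar>z\<bar> z)"
    and slt3: "\<And>x z. strictly_lower_triangular (partial3 c x \<bar>z\<bar> z)"
    and \<phi>_eq: "\<And>x. \<phi> x = f (x, \<bar>solution_operator c x\<bar>, solution_operator c x)"

lemma evaluation_procedure_switching_system:
  assumes "evaluation_procedure f c \<phi>"
  shows "\<exists>f' c'. switching_system f c f' c' \<phi>"
proof -
  have *: "\<exists>g'. (\<forall>p. (g has_derivative blinfun_apply (g' p)) (at p)) \<and> continuous_on UNIV g'"
    if C2: "C2 g" for g :: "'x::real_normed_vector \<Rightarrow> 'y::real_normed_vector"
  proof -
    obtain g' :: "'x \<Rightarrow> 'x \<Rightarrow>\<^sub>L 'y" and g'' :: "'x \<Rightarrow> 'x \<Rightarrow>\<^sub>L 'x \<Rightarrow>\<^sub>L 'y"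
      where g': "\<forall>p. (g has_derivative blinfun_apply (g' p)) (at p)"
        and g'': "\<And>p. (g' has_derivative blinfun_apply (g'' p)) (at p)"
      using C2 unfolding C2_def by blast
    have "continuous_on UNIV g'"
      by (intro continuous_at_imp_continuous_on ballI has_derivative_continuous[OF g''])
    with g' show ?thesis by blast
  qed
  from assms obtain f' c' where
    "\<forall>p. (f has_derivative blinfun_apply (f' p)) (at p)" "continuous_on UNIV f'"
    "\<forall>p. (c has_derivative blinfun_apply (c' p)) (at p)" "continuous_on UNIV c'"
    unfolding evaluation_procedure_def using *[of f] *[of c] by blast
  with assms have "switching_system f c f' c' \<phi>"
    unfolding evaluation_procedure_def by unfold_locales auto
  then show ?thesis by blast
qed

context switching_system
begin

lemma causal_c: "causal (\<lambda>z. c (x, \<bar>z\<bar>, z))"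
  by (rule causal_switching_map[OF der_c slt2 slt3])

text \<open>The condition on \<^term>\<open>\<xi>\<close> says that it is admissible at \<^term>\<open>x0\<close>.\<close>

lemma smooth_model_derivative:
  assumes adm: "diag_mat \<xi> *v solution_operator c x0 = \<bar>solution_operator c x0\<bar>"
  defines "w \<equiv> modified_solution_operator c x0 \<xi>"
    and "z0 \<equiv> solution_operator c x0"
  obtains W Y D where "open W" "x0 \<in> W" "w x0 = z0"
    and "\<And>x. x \<in> W \<Longrightarrow> w x = c (x, diag_mat \<xi> *v w x, w x)"
    and "\<And>x. x \<in> W \<Longrightarrow> isCont w x"
    and "(w has_derivative Y) (at x0)"
    and "\<And>d. tangent_solution (partial1 c x0 \<bar>z0\<bar> z0) (partial2 c x0 \<bar>z0\<bar> z0)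
          (partial3 c x0 \<bar>z0\<bar> z0) \<xi> d (Y d)"
    and "\<And>x. x \<in> W \<Longrightarrow> (smooth_model f c x0 \<xi> has_derivative D x) (at x)"
    and "\<And>d. D x0 d = f' (x0, \<bar>z0\<bar>, z0) (d, diag_mat \<xi> *v Y d, Y d)"
    and "\<And>d. isCont (\<lambda>x. D x d) x0"
proof -
  have z0: "solution_operator c x0 = z0" and adm': "diag_mat \<xi> *v z0 = \<bar>z0\<bar>"
    using adm by (simp_all add: z0_def)
  \<comment> \<open>Admissibility makes \<open>z0\<close> solve the modified equation too, and
    places the partial derivatives at \<open>(x0, \<bar>z0\<bar>, z0)\<close>, where triangularity
    is known.\<close>
  have eq: "z0 = c (x0, diag_mat \<xi> *v z0, z0)"
    unfolding adm' using solution_operator_solves[OF causal_c] unfolding z0_def .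
  have slt: "strictly_lower_triangular (partial2 c x0 (diag_mat \<xi> *v z0) z0)"
    "strictly_lower_triangular (partial3 c x0 (diag_mat \<xi> *v z0) z0)"
    unfolding adm' by (rule slt2 slt3)+
  obtain W Y where W: "open W" "x0 \<in> W" "w x0 = z0"
    and w: "\<And>x. x \<in> W \<Longrightarrow> w x = c (x, diag_mat \<xi> *v w x, w x)"
    and der_w: "\<And>x. x \<in> W \<Longrightarrow> (w has_derivative Y x) (at x)"
    and Y: "\<And>x d. x \<in> W \<Longrightarrow> Y x d = c' (x, diag_mat \<xi> *v w x, w x) (d, diag_mat \<xi> *v Y x d, Y x d)"
    and cont_Y: "\<And>d. isCont (\<lambda>x. Y x d) x0"
    unfolding w_def
    apply (rule modified_solution_branch[OF der_c cont_c' slt z0 eq])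
    subgoal premises prems for W Y
      using prems(2-) by (rule prems(1))
    done
  define D where "D x d = f' (x, diag_mat \<xi> *v w x, w x) (d, diag_mat \<xi> *v Y x d, Y x d)" for x d
  have cont_w: "isCont w x" if "x \<in> W" for x
    using der_w[OF that] by (rule has_derivative_continuous)
  have bl: "bounded_linear ((*v) (diag_mat \<xi>))"
    by (rule matrix_vector_mul_bounded_linear)
  show ?thesis
  proof (rule that[OF W w cont_w der_w[OF W(2)]])
    fix d
    show "tangent_solution (partial1 c x0 \<bar>z0\<bar> z0) (partial2 c x0 \<bar>z0\<bar> z0)
        (partial3 c x0 \<bar>z0\<bar> z0) \<xi> d (Y x0 d)"
      using Y[OF W(2), of d]
      unfolding tangent_solution_def W(3) adm' partial_derivatives(4)[OF der_c] .
    show "D x0 d = f' (x0, \<bar>z0\<bar>, z0) (d, diag_mat \<xi> *v Y x0 d, Y x0 d)"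
      by (simp add: D_def W(3) adm')
    have "isCont (\<lambda>x. (x, diag_mat \<xi> *v w x, w x)) x0"
      by (intro continuous_intros bounded_linear.continuous[OF bl] cont_w W(2))
    moreover have "isCont f' p" for p
      using cont_f' unfolding continuous_on_eq_continuous_at[OF open_UNIV] by blast
    ultimately have "isCont (\<lambda>x. f' (x, diag_mat \<xi> *v w x, w x)) x0"
      by (rule isCont_o2)
    then show "isCont (\<lambda>x. D x d) x0"
      unfolding D_def
      by (intro continuous_intros bounded_linear.continuous[OF bl] cont_Y)
  next
    fix x assume x: "x \<in> W"
    have "((\<lambda>x. (x, diag_mat \<xi> *v w x, w x)) has_derivative
        (\<lambda>d. (d, diag_mat \<xi> *v Y x d, Y x d))) (at x)"
      by (intro derivative_intros bounded_linear.has_derivative[OF bl] der_w x)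
    then show "(smooth_model f c x0 \<xi> has_derivative D x) (at x)"
      unfolding smooth_model_def[abs_def] D_def w_def[symmetric]
      by (rule has_derivative_compose) (rule der_f)
  qed
qed

lemma smooth_model_gradient:
  fixes x0 :: "real^'n"
  defines "z0 \<equiv> solution_operator c x0"
  assumes adm: "diag_mat \<xi> *v z0 = \<bar>z0\<bar>"
  obtains y where "tangent_solution (partial1 c x0 \<bar>z0\<bar> z0) (partial2 c x0 \<bar>z0\<bar> z0)
          (partial3 c x0 \<bar>z0\<bar> z0) \<xi> d y"
    and "gradient (smooth_model f c x0 \<xi>) x0 \<bullet> d = f' (x0, \<bar>z0\<bar>, z0) (d, diag_mat \<xi> *v y, y)"
proof (rule smooth_model_derivative[OF adm[unfolded z0_def], folded z0_def])
  fix W Y D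
  assume "x0 \<in> W" and Y: "\<And>d. tangent_solution (partial1 c x0 \<bar>z0\<bar> z0) (partial2 c x0 \<bar>z0\<bar> z0)
      (partial3 c x0 \<bar>z0\<bar> z0) \<xi> d (Y d)"
    and D: "\<And>x. x \<in> W \<Longrightarrow> (smooth_model f c x0 \<xi> has_derivative D x) (at x)"
      "\<And>d. D x0 d = f' (x0, \<bar>z0\<bar>, z0) (d, diag_mat \<xi> *v Y d, Y d)"
  show thesis
    using that[OF Y] gradient_inner[OF D(1)[OF \<open>x0 \<in> W\<close>]] D(2) by simp
qed

text \<open>A smooth model whose switching variables have the signs prescribed by \<^term>\<open>\<xi>\<close> solves the
  original switching equation, and it still does so in a neighbourhood.\<close>

lemma has_derivative_of_smooth_model:
  assumes W: "open W" "x \<in> W"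
    and w: "\<And>x. x \<in> W \<Longrightarrow> w x = c (x, diag_mat \<xi> *v w x, w x)"
    and cont: "\<And>x. x \<in> W \<Longrightarrow> isCont w x"
    and w_def: "w = modified_solution_operator c x0 \<xi>"
    and \<xi>: "\<And>k. \<xi> $ k \<in> {-1, 1}" and pos: "\<And>k. 0 < \<xi> $ k * w x $ k"
    and der: "(smooth_model f c x0 \<xi> has_derivative D) (at x)"
  shows "(\<phi> has_derivative D) (at x)"
proof -
  define S where "S = {x' \<in> W. \<forall>k. 0 < \<xi> $ k * w x' $ k}"
  have cont_w: "continuous_on W w"
    using cont by (intro continuous_at_imp_continuous_on) blast
  have "open {x' \<in> W. 0 < \<xi> $ k * w x' $ k}" for k
  proof -
    have "continuous_on W (\<lambda>x. \<xi> $ k * w x $ k)"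
      by (intro continuous_intros cont_w)
    from continuous_open_preimage[OF this W(1) open_greaterThan[of 0]] show ?thesis
      by (simp add: vimage_def Int_def)
  qed
  then have "open (\<Inter>k. {x' \<in> W. 0 < \<xi> $ k * w x' $ k})"
    by (intro open_INT) auto
  also have "(\<Inter>k. {x' \<in> W. 0 < \<xi> $ k * w x' $ k}) = S"
    by (auto simp: S_def)
  finally have "open S" .
  have "smooth_model f c x0 \<xi> x' = \<phi> x'" if "x' \<in> S" for x'
  proof -
    have "\<xi> $ k * w x' $ k = \<bar>w x' $ k\<bar>" for k
    proof -
      have "0 < \<xi> $ k * w x' $ k"
        using that by (simp add: S_def)
      then show ?thesis
        using \<xi>[of k] by auto
    qed
    then have abs: "diag_mat \<xi> *v w x' = \<bar>w x'\<bar>"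
      by (simp add: vec_eq_iff abs_vec_def)
    have "solution_operator c x' = w x'"
      using w[of x'] that unfolding abs by (intro solution_operator_eqI causal_c) (simp add: S_def)
    then show ?thesis
      unfolding smooth_model_def \<phi>_eq w_def[symmetric] abs by simp
  qed
  then show ?thesis
    using has_derivative_transform_within_open[OF der \<open>open S\<close>] W(2) pos by (simp add: S_def)
qed

text \<open>Changing one component of the parameter changes the tangent solution and its product
  with the parameter affinely; the derivative of \<open>f\<close> at the base point is linear in
  both.\<close>

lemma gradient_smooth_model_affine:
  fixes x0 :: "real^'n"
  defines "z0 \<equiv> solution_operator c x0"
  defines "grad \<zeta> \<equiv> gradient (smooth_model f c x0 (fill_signs (sign_vec z0) \<zeta>)) x0"
  shows "grad \<zeta> = ((1 + \<zeta> $ k) / 2) *\<^sub>R grad (\<chi> i. if i = k then 1 else \<zeta> $ i)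
    + ((1 - \<zeta> $ k) / 2) *\<^sub>R grad (\<chi> i. if i = k then -1 else \<zeta> $ i)"
proof (rule vector_eq_rdot[THEN iffD1], rule allI)
  fix d
  let ?a = "(1 + \<zeta> $ k) / 2" and ?b = "(1 - \<zeta> $ k) / 2"
  let ?\<zeta>1 = "\<chi> i. if i = k then 1 else \<zeta> $ i" and ?\<zeta>2 = "\<chi> i. if i = k then -1 else \<zeta> $ i"
  let ?F = "fill_signs (sign_vec z0)" and ?f = "blinfun_apply (f' (x0, \<bar>z0\<bar>, z0))"
  let ?T = "tangent_solution (partial1 c x0 \<bar>z0\<bar> z0) (partial2 c x0 \<bar>z0\<bar> z0) (partial3 c x0 \<bar>z0\<bar> z0)"
  have grad: "\<exists>y. ?T (?F \<zeta>) d y \<and> grad \<zeta> \<bullet> d = ?f (d, diag_mat (?F \<zeta>) *v y, y)" for \<zeta>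
    unfolding z0_def grad_def by (rule smooth_model_gradient[OF fill_signs_admissible]) blast
  obtain y where y: "?T (?F \<zeta>) d y" "grad \<zeta> \<bullet> d = ?f (d, diag_mat (?F \<zeta>) *v y, y)"
    using grad by blast
  obtain y1 where y1: "?T (?F ?\<zeta>1) d y1" "grad ?\<zeta>1 \<bullet> d = ?f (d, diag_mat (?F ?\<zeta>1) *v y1, y1)"
    using grad by blast
  obtain y2 where y2: "?T (?F ?\<zeta>2) d y2" "grad ?\<zeta>2 \<bullet> d = ?f (d, diag_mat (?F ?\<zeta>2) *v y2, y2)"
    using grad by blast
  have ab: "?a + ?b = 1"
    by (simp add: field_simps)
  \<comment> \<open>Where the sign is nonzero, or away from \<open>k\<close>, both fillings agree
    and the weights add up to 1; otherwise the weights recover \<open>\<zeta> $ k\<close> from 1 and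
    -1.\<close>
  have mix: "?a *\<^sub>R ?F ?\<zeta>1 + ?b *\<^sub>R ?F ?\<zeta>2 = ?F \<zeta>"
    by (simp add: vec_eq_iff field_simps)
  have agree: "?F ?\<zeta>1 $ i = ?F ?\<zeta>2 $ i" if "i \<noteq> k" for i
    using that by simp
  note aff = tangent_solution_affine[OF slt2 slt3 y1(1) y2(1) agree ab, unfolded mix]
  have y_eq: "y = ?a *\<^sub>R y1 + ?b *\<^sub>R y2"
    by (rule tangent_solution_unique[OF slt2 slt3 y(1) aff(2)])
  have prod: "diag_mat (?F \<zeta>) *v y
      = ?a *\<^sub>R (diag_mat (?F ?\<zeta>1) *v y1) + ?b *\<^sub>R (diag_mat (?F ?\<zeta>2) *v y2)"
    unfolding y_eq by (rule aff(1))
  have "?a *\<^sub>R d + ?b *\<^sub>R d = d"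
    unfolding scaleR_left_distrib[symmetric] ab by simp
  then have triple: "(d, diag_mat (?F \<zeta>) *v y, y)
      = ?a *\<^sub>R (d, diag_mat (?F ?\<zeta>1) *v y1, y1) + ?b *\<^sub>R (d, diag_mat (?F ?\<zeta>2) *v y2, y2)"
    unfolding prod by (simp only: y_eq scaleR_Pair add_Pair)
  show "grad \<zeta> \<bullet> d = (?a *\<^sub>R grad ?\<zeta>1 + ?b *\<^sub>R grad ?\<zeta>2) \<bullet> d"
    unfolding y(2) triple
    by (simp only: inner_add_left inner_scaleR_left y1(2) y2(2) blinfun.add_right blinfun.scaleR_right
        real_scaleR_def)
qed

end

section \<open>Gradients along a direction\<close>

text \<open>Along the ray in direction \<open>d\<close> a switching variable that is nonzero at
  \<open>x0\<close> keeps its sign, and a vanishing one takes the sign \<open>\<tau> $ k\<close> of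
  its slope \<open>y $ k\<close>. There the smooth model coincides with \<open>\<phi>\<close>
  locally and passes on its derivative.\<close>

lemma (in switching_system) eventually_active:
  fixes x0 :: "real^'n"
  defines "z0 \<equiv> solution_operator c x0"
  assumes \<tau>: "\<And>k. \<tau> $ k \<in> {-1, 1}"
    and y: "tangent_solution (partial1 c x0 \<bar>z0\<bar> z0) (partial2 c x0 \<bar>z0\<bar> z0) (partial3 c x0 \<bar>z0\<bar> z0)
        (fill_signs (sign_vec z0) \<tau>) d y"
    and pos: "\<And>k. 0 < \<tau> $ k * y $ k"
  obtains D where
    "\<forall>\<^sub>F t in at_right 0. (\<phi> has_derivative D (x0 + t *\<^sub>R d)) (at (x0 + t *\<^sub>R d))"
    "(smooth_model f c x0 (fill_signs (sign_vec z0) \<tau>) has_derivative D x0) (at x0)"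
    "\<And>e. isCont (\<lambda>x. D x e) x0"
proof -
  define \<xi> where "\<xi> = fill_signs (sign_vec z0) \<tau>"
  define w where "w = modified_solution_operator c x0 \<xi>"
  have adm: "diag_mat \<xi> *v solution_operator c x0 = \<bar>solution_operator c x0\<bar>"
    unfolding \<xi>_def z0_def by (rule fill_signs_admissible)
  have \<xi>: "\<xi> $ k \<in> {-1, 1}" for k
    using \<tau>[of k] by (auto simp: \<xi>_def sign_vec_def sgn_if)
  show ?thesis
  proof (rule smooth_model_derivative[OF adm, folded w_def, folded z0_def])
    fix W Y D
    assume W: "open W" "x0 \<in> W" "w x0 = z0"
      and w: "\<And>x. x \<in> W \<Longrightarrow> w x = c (x, diag_mat \<xi> *v w x, w x)"
      and cont_w: "\<And>x. x \<in> W \<Longrightarrow> isCont w x"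
      and der_w: "(w has_derivative Y) (at x0)"
      and Y: "\<And>d. tangent_solution (partial1 c x0 \<bar>z0\<bar> z0) (partial2 c x0 \<bar>z0\<bar> z0)
          (partial3 c x0 \<bar>z0\<bar> z0) \<xi> d (Y d)"
      and D: "\<And>x. x \<in> W \<Longrightarrow> (smooth_model f c x0 \<xi> has_derivative D x) (at x)"
      and cont_D: "\<And>d. isCont (\<lambda>x. D x d) x0"
    have y_eq: "Y d = y"
      using tangent_solution_unique[OF slt2 slt3 Y y[folded \<xi>_def]] .
    have line: "((\<lambda>t. x0 + t *\<^sub>R d) has_derivative (\<lambda>t. t *\<^sub>R d)) (at 0)"
      by (auto intro!: derivative_eq_intros)
    have "\<forall>\<^sub>F t in at_right 0. 0 < \<xi> $ k * w (x0 + t *\<^sub>R d) $ k" for k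
    proof (rule eventually_pos_at_right)
      have "((\<lambda>t. w (x0 + t *\<^sub>R d)) has_derivative (\<lambda>t. Y (t *\<^sub>R d))) (at 0)"
        by (rule has_derivative_compose[OF line]) (simp add: der_w)
      then have "((\<lambda>t. \<xi> $ k * w (x0 + t *\<^sub>R d) $ k) has_derivative (\<lambda>t. \<xi> $ k * Y (t *\<^sub>R d) $ k)) (at 0)"
        by (intro has_derivative_mult_right bounded_linear.has_derivative[OF bounded_linear_vec_nth])
      moreover have "\<xi> $ k * Y (t *\<^sub>R d) $ k = \<xi> $ k * y $ k * t" for t
        using has_derivative_linear[OF der_w] by (simp add: linear_scale y_eq)
      ultimately show "((\<lambda>t. \<xi> $ k * w (x0 + t *\<^sub>R d) $ k) has_real_derivative \<xi> $ k * y $ k) (at 0)"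
        by (simp add: has_field_derivative_def)
      \<comment> \<open>At \<open>t = 0\<close> the product is \<open>\<bar>z0 $ k\<bar>\<close>; if
        that is 0, then \<open>\<xi> $ k = \<tau> $ k\<close> and \<open>pos\<close> gives the
        slope.\<close>
      show "0 \<le> \<xi> $ k * w (x0 + 0 *\<^sub>R d) $ k"
        by (auto simp: W(3) \<xi>_def sign_vec_def sgn_if)
      show "0 < \<xi> $ k * y $ k" if "\<xi> $ k * w (x0 + 0 *\<^sub>R d) $ k = 0"
        using that pos[of k] by (auto simp: W(3) \<xi>_def sign_vec_def sgn_if split: if_splits)
    qed
    then have "\<forall>\<^sub>F t in at_right 0. \<forall>k. 0 < \<xi> $ k * w (x0 + t *\<^sub>R d) $ k"
      by (rule eventually_all_finite)
    moreover have "\<forall>\<^sub>F t in at_right 0. x0 + t *\<^sub>R d \<in> W"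
    proof -
      have "((\<lambda>t. x0 + t *\<^sub>R d) \<longlongrightarrow> x0 + 0 *\<^sub>R d) (at_right 0)"
        by (intro tendsto_intros)
      then show ?thesis
        using W(1,2) by (intro topological_tendstoD) auto
    qed
    ultimately have "\<forall>\<^sub>F t in at_right 0. (\<phi> has_derivative D (x0 + t *\<^sub>R d)) (at (x0 + t *\<^sub>R d))"
    proof eventually_elim
      case (elim t)
      then show ?case
        by (intro has_derivative_of_smooth_model[OF W(1) elim(2) w cont_w w_def \<xi> _ D]) auto
    qed
    then show thesis
      using that D[OF W(2)] cont_D unfolding \<xi>_def by blast
  qed
qed

section \<open>Averaged gradients: limiting and Clarke inclusions\<close>

theorem theorem10:
  fixes J :: nat and JJ :: "nat set"
    and x0 :: "real^('n::finite)"
    and f :: "nat \<Rightarrow> (real^'n) \<times> (real^('s::{finite,linorder})) \<times> (real^('s::{finite,linorder})) \<Rightarrow> real"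
    and c :: "nat \<Rightarrow> (real^'n) \<times> (real^('s::{finite,linorder})) \<times> (real^('s::{finite,linorder})) \<Rightarrow> real^('s::{finite,linorder})"
    and \<phi> :: "nat \<Rightarrow> real^'n \<Rightarrow> real"
    and z0 \<sigma>0 :: "nat \<Rightarrow> real^('s::{finite,linorder})"
    and Z :: "nat \<Rightarrow> real^'n^('s::{finite,linorder})"
  assumes "JJ \<subseteq> {1..J}" and "JJ \<noteq> {}"
    and "\<And>j. j \<in> JJ \<Longrightarrow> evaluation_procedure (f j) (c j) (\<phi> j)"
    and "\<And>j. j \<in> JJ \<Longrightarrow> z0 j = solution_operator (c j) x0"
    and "\<And>j. j \<in> JJ \<Longrightarrow> \<sigma>0 j = sign_vec (z0 j)"
    and "\<And>j. j \<in> JJ \<Longrightarrow> Z j = partial1 (c j) x0 \<bar>z0 j\<bar> (z0 j)"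
    and "\<exists>Zr :: real^('s::{finite,linorder})^'n. \<forall>j\<in>JJ. Z j ** Zr = mat 1"
  shows "(\<forall>\<tau> :: real^('s::{finite,linorder}). (\<forall>k. \<tau> $ k \<in> {-1, 1}) \<longrightarrow>
            (1 / real (card JJ)) *\<^sub>R
              (\<Sum>j\<in>JJ. gradient (smooth_model (f j) (c j) x0 (fill_signs (\<sigma>0 j) \<tau>)) x0)
            \<in> limiting_gradients (\<lambda>x. (1 / real (card JJ)) * (\<Sum>j\<in>JJ. \<phi> j x)) x0) \<and>
         (\<forall>\<zeta> :: real^('s::{finite,linorder}). (\<forall>k. \<zeta> $ k \<in> {-1..1}) \<longrightarrow>
            (1 / real (card JJ)) *\<^sub>R
              (\<Sum>j\<in>JJ. gradient (smooth_model (f j) (c j) x0 (fill_signs (\<sigma>0 j) \<zeta>)) x0)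
            \<in> clarke_gradients (\<lambda>x. (1 / real (card JJ)) * (\<Sum>j\<in>JJ. \<phi> j x)) x0)"
proof -
  have "finite JJ"
    using assms(1) finite_subset by blast
  obtain Zr where Zr: "\<And>j. j \<in> JJ \<Longrightarrow> Z j ** Zr = mat 1"
    using assms(7) by blast
  obtain f' c' where sys: "\<And>j. j \<in> JJ \<Longrightarrow> switching_system (f j) (c j) (f' j) (c' j) (\<phi> j)"
    using evaluation_procedure_switching_system[OF assms(3)] by metis
  define \<Phi> where "\<Phi> x = (1 / real (card JJ)) * (\<Sum>j\<in>JJ. \<phi> j x)" for x
  define g where "g j \<zeta> = gradient (smooth_model (f j) (c j) x0 (fill_signs (\<sigma>0 j) \<zeta>)) x0" for j \<zeta>
  define H where "H \<zeta> = (1 / real (card JJ)) *\<^sub>R (\<Sum>j\<in>JJ. g j \<zeta>)" for \<zeta>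
  have limiting: "H \<tau> \<in> limiting_gradients \<Phi> x0" if \<tau>: "\<And>k. \<tau> $ k \<in> {-1, 1}" for \<tau>
  proof -
    define A where "A j = partial2 (c j) x0 \<bar>z0 j\<bar> (z0 j)" for j
    define B where "B j = partial3 (c j) x0 \<bar>z0 j\<bar> (z0 j)" for j
    define \<xi> where "\<xi> j = fill_signs (\<sigma>0 j) \<tau>" for j
    have "causal (\<lambda>y. 0 + A j *v (diag_mat (\<xi> j) *v y) + B j *v y)" if "j \<in> JJ" for j
      unfolding A_def B_def
      by (intro causal_tangent_map switching_system.slt2[OF sys] switching_system.slt3[OF sys] that)
    then obtain v y where y: "\<And>j. j \<in> JJ \<Longrightarrow>
          y j = v + (0 + A j *v (diag_mat (\<xi> j) *v y j) + B j *v y j)"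
        and pos: "\<And>j k. j \<in> JJ \<Longrightarrow> 0 < \<tau> $ k * y j $ k"
      by (rule causal_fixpoints_dominated[OF \<open>finite JJ\<close> _ \<tau>]) blast+
    \<comment> \<open>The common right-inverse gives \<open>Z j *v d = v\<close> for all
      \<open>j\<close>, so this one direction realizes the tangent solutions \<open>y j\<close> of
      all models.\<close>
    define d where "d = Zr *v v"
    have "\<exists>D. (\<forall>\<^sub>F t in at_right 0. (\<phi> j has_derivative D (x0 + t *\<^sub>R d)) (at (x0 + t *\<^sub>R d))) \<and>
        (smooth_model (f j) (c j) x0 (\<xi> j) has_derivative D x0) (at x0) \<and>
        (\<forall>e. isCont (\<lambda>x. D x e) x0)" if j: "j \<in> JJ" for j
    proof -
      have "Z j *v d = v"
        by (simp add: d_def matrix_vector_mul_assoc Zr[OF j])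
      then have "tangent_solution (Z j) (A j) (B j) (\<xi> j) d (y j)"
        unfolding tangent_solution_def using y[OF j] by (simp only: add_0 add.assoc)
      from this[unfolded A_def B_def \<xi>_def assms(5,6)[OF j] assms(4)[OF j]]
      show ?thesis
        unfolding \<xi>_def assms(5)[OF j] assms(4)[OF j]
        by (rule switching_system.eventually_active[OF sys[OF j] \<tau> _ pos[OF j]]) blast
    qed
    then have "\<forall>j\<in>JJ. \<exists>D. (\<forall>\<^sub>F t in at_right 0. (\<phi> j has_derivative D (x0 + t *\<^sub>R d)) (at (x0 + t *\<^sub>R d))) \<and>
        (smooth_model (f j) (c j) x0 (\<xi> j) has_derivative D x0) (at x0) \<and>
        (\<forall>e. isCont (\<lambda>x. D x e) x0)"
      by blast
    from bchoice[OF this] obtain D where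
      D: "\<And>j. j \<in> JJ \<Longrightarrow> \<forall>\<^sub>F t in at_right 0. (\<phi> j has_derivative D j (x0 + t *\<^sub>R d)) (at (x0 + t *\<^sub>R d))"
      and D0: "\<And>j. j \<in> JJ \<Longrightarrow> (smooth_model (f j) (c j) x0 (\<xi> j) has_derivative D j x0) (at x0)"
      and cont_D: "\<And>j e. j \<in> JJ \<Longrightarrow> isCont (\<lambda>x. D j x e) x0"
      by blast
    have "\<forall>\<^sub>F t in at_right 0. \<forall>j\<in>JJ. (\<phi> j has_derivative D j (x0 + t *\<^sub>R d)) (at (x0 + t *\<^sub>R d))"
      by (rule eventually_ball_finite[OF \<open>finite JJ\<close>]) (use D in blast)
    moreover have seq: "filterlim (\<lambda>m. inverse (real (Suc m))) (at_right 0) sequentially"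
      using LIMSEQ_inverse_real_of_nat by (auto simp: filterlim_at)
    ultimately have "\<forall>\<^sub>F m in sequentially. \<forall>j\<in>JJ. (\<phi> j has_derivative
        D j (x0 + inverse (real (Suc m)) *\<^sub>R d)) (at (x0 + inverse (real (Suc m)) *\<^sub>R d))"
      unfolding filterlim_iff by blast
    then obtain N where N: "\<And>m j. N \<le> m \<Longrightarrow> j \<in> JJ \<Longrightarrow> (\<phi> j has_derivative
        D j (x0 + inverse (real (Suc m)) *\<^sub>R d)) (at (x0 + inverse (real (Suc m)) *\<^sub>R d))"
      unfolding eventually_sequentially by blast
    \<comment> \<open>The shift by \<open>N\<close> makes all \<open>\<phi> j\<close> differentiable
      at every point of the sequence, not only eventually.\<close>
    define X where "X m = x0 + inverse (real (Suc (m + N))) *\<^sub>R d" for m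
    have der: "(\<Phi> has_derivative (\<lambda>e. (1 / real (card JJ)) * (\<Sum>j\<in>JJ. D j (X m) e))) (at (X m))" for m
      unfolding \<Phi>_def
      by (intro has_derivative_mult_right has_derivative_sum) (simp add: X_def N del: of_nat_Suc)
    have "(\<lambda>m. x0 + inverse (real (Suc (m + N))) *\<^sub>R d) \<longlonglongrightarrow> x0 + 0 *\<^sub>R d"
      by (intro tendsto_intros LIMSEQ_ignore_initial_segment LIMSEQ_inverse_real_of_nat)
    then have X: "X \<longlonglongrightarrow> x0"
      by (simp add: X_def[abs_def])
    have "(\<lambda>m. gradient \<Phi> (X m)) \<longlonglongrightarrow> H \<tau>"
    \<comment> \<open>Tested against a basis vector, the limit is continuity of \<open>D j\<close>
      at \<open>x0\<close> in a fixed direction, and \<open>D j x0\<close> is the derivative of the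
      smooth model.\<close>
    proof (subst tendsto_componentwise_iff, intro ballI)
      fix b :: "real^'n"
      have "H \<tau> \<bullet> b = (1 / real (card JJ)) * (\<Sum>j\<in>JJ. D j x0 b)"
        unfolding H_def g_def by (simp add: inner_sum_left gradient_inner[OF D0, unfolded \<xi>_def])
      moreover have "(\<lambda>m. (1 / real (card JJ)) * (\<Sum>j\<in>JJ. D j (X m) b))
          \<longlonglongrightarrow> (1 / real (card JJ)) * (\<Sum>j\<in>JJ. D j x0 b)"
        by (intro tendsto_intros isCont_tendsto_compose[OF cont_D X])
      ultimately show "(\<lambda>m. gradient \<Phi> (X m) \<bullet> b) \<longlonglongrightarrow> H \<tau> \<bullet> b"
        by (simp add: gradient_inner[OF der])
    qed
    moreover have "\<Phi> differentiable (at (X m))" for m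
      using der differentiableI by blast
    ultimately show ?thesis
      unfolding limiting_gradients_def using X by blast
  qed
  have "H \<zeta> \<in> clarke_gradients \<Phi> x0" if \<zeta>: "\<And>k. \<zeta> $ k \<in> {-1..1}" for \<zeta>
  proof -
    have split: "H \<zeta> = ((1 + \<zeta> $ k) / 2) *\<^sub>R H (\<chi> i. if i = k then 1 else \<zeta> $ i)
        + ((1 - \<zeta> $ k) / 2) *\<^sub>R H (\<chi> i. if i = k then -1 else \<zeta> $ i)" for \<zeta> k
    proof -
      have "g j \<zeta> = ((1 + \<zeta> $ k) / 2) *\<^sub>R g j (\<chi> i. if i = k then 1 else \<zeta> $ i)
          + ((1 - \<zeta> $ k) / 2) *\<^sub>R g j (\<chi> i. if i = k then -1 else \<zeta> $ i)" if "j \<in> JJ" for j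
        unfolding g_def assms(5)[OF that] assms(4)[OF that]
        by (rule switching_system.gradient_smooth_model_affine[OF sys[OF that]])
      then have "(\<Sum>j\<in>JJ. g j \<zeta>) = (\<Sum>j\<in>JJ. ((1 + \<zeta> $ k) / 2) *\<^sub>R g j (\<chi> i. if i = k then 1 else \<zeta> $ i)
          + ((1 - \<zeta> $ k) / 2) *\<^sub>R g j (\<chi> i. if i = k then -1 else \<zeta> $ i))"
        by (rule sum.cong[OF refl])
      then show ?thesis
        unfolding H_def
        by (simp only: sum.distrib scaleR_sum_right[symmetric] scaleR_add_right scaleR_left_commute)
    qed
    \<comment> \<open>At the vertices of the cube the first claim supplies limiting
      gradients.\<close>
    have "H \<zeta> \<in> convex hull (H ` {\<tau>. \<forall>i. \<tau> $ i \<in> {-1, 1}})"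
      by (rule multi_affine_in_vertex_hull[OF split \<zeta>])
    also have "\<dots> \<subseteq> convex hull (limiting_gradients \<Phi> x0)"
      by (intro hull_mono image_subsetI limiting) blast
    finally show ?thesis
      unfolding clarke_gradients_def .
  qed
  with limiting show ?thesis
    unfolding H_def g_def \<Phi>_def[abs_def] by blast
qed

end
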